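(* Let $G$ be a square geometric $\mathcal{B}_{a,b}$-graph satisfying Assumption A. Then: (i) there is a proper 2-coloring $f:V(\tilde G)\to\{\text{red},\text{blue}\}$ of the chord graph that colors all vertices of $\mathcal{A}$ red and all vertices of $\mathcal{B}$ blue; and (ii) the rigid-free conditions hold.
   Context: $u\sim v$ denotes adjacency, $N(v)$ the neighborhood, $N_S(v)=N(v)\cap S$. A graph is square geometric if there is $p:V(G)\to\mathbb{R}^2$ with distinct $u,v$ adjacent iff $\|p(u)-p(v)\|_\infty\le1$. A binate interval graph is a graph whose vertex set can be partitioned into two sets each inducing a connected unit interval graph. A $\mathcal{B}_{a,b}$-graph is a binate interval graph whose vertex set can be partitioned into $X=X_a\cup X_b$ and $Y$ (its clique bipartition), where $X_a,X_b,Y$ are cliques and $X_a\cap X_b\ne\emptyset$. A rigid pair is a pair $\{x_1y_1,x_2y_2\}$ of edges with $x_1,x_2\in X$, $y_1,y_2\in Y$ such that $x_1y_1y_2x_2$ is an induced 4-cycle; its chords are $x_1y_2,x_2y_1$. The chord graph $\tilde G$ has vertex set the non-edges $xy$ with $x\in X,y\in Y$; two of them are adjacent iff they are the two chords of a rigid pair. An $a$-vertex is a vertex $ay$ of $\tilde G$ with $a\in X_a\setminus X_b$; a $b$-vertex is a vertex $by$ with $b\in X_b\setminus X_a$. $\mathcal{A}$ is the set of non-isolated $a$-vertices having a neighbor in $\tilde G$ that is not an $a$-vertex; $\mathcal{B}$ is the set of $b$-vertices having a neighbor in $\tilde G$ that is not a $b$-vertex. Assumption A: $\tilde G$ is connected;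 for every $v\in (X_a\setminus X_b)\cup(X_b\setminus X_a)$ we have $0<|N_Y(v)|<|Y|$; for every $b\in X_b\setminus X_a$ there is $u\in X_a\cup X_b$ with $N_Y(b)\not\subseteq N_Y(u)$; and $\tilde G$ has an edge neither of whose ends is an $a$-vertex or a $b$-vertex. A vertex $v\in X$ is rigid-free with respect to $S\subseteq X$ if there is no rigid pair $\{x_1y_1,x_2y_2\}$ with $\{x_1,x_2\}\subseteq S$ and $y_1,y_2\in N_Y(v)$. The rigid-free conditions: at least one of (i') every $a\in X_a\setminus X_b$ is rigid-free with respect to every set $\{x_1,x_2\}$ and every set $\{x,b\}$ with $x,x_1,x_2\in X_a\cap X_b$, $b\in X_b\setminus X_a$; (ii') every $b\in X_b\setminus X_a$ is rigid-free with respect to every set $\{x_1,x_2\}$ and every set $\{x,a\}$ with $x,x_1,x_2\in X_a\cap X_b$, $a\in X_a\setminus X_b$.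
   Formalization: X_a and X_b are taken to be exactly the maximal cliques of G[X] (so either X_a = X_b, or X_a∖X_b and X_b∖X_a are both nonempty with no edges between them); for arbitrary cliques covering X the claim is false. *)

theory Defs
  imports "HOL-Analysis.Analysis"
begin

text \<open>A graph is given by its vertex set \<open>V\<close> and its adjacency relation \<open>E\<close>;
  \<open>E\<close> together with a set \<open>S\<close> stands for the subgraph induced by \<open>S\<close>.\<close>

definition simple_graph :: "'a set \<Rightarrow> ('a \<Rightarrow> 'a \<Rightarrow> bool) \<Rightarrow> bool" where
  "simple_graph V E \<longleftrightarrow> finite V \<and>
     (\<forall>u v. E u v \<longrightarrow> u \<in> V \<and> v \<in> V \<and> u \<noteq> v \<and> E v u)"

definition nbhd_in :: "('a \<Rightarrow> 'a \<Rightarrow> bool) \<Rightarrow> 'a set \<Rightarrow> 'a \<Rightarrow> 'a set" where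
  "nbhd_in E S v = {u \<in> S. E v u}"

definition connected_graph :: "'a set \<Rightarrow> ('a \<Rightarrow> 'a \<Rightarrow> bool) \<Rightarrow> bool" where
  "connected_graph S E \<longleftrightarrow> S \<noteq> {} \<and>
     (\<forall>u\<in>S. \<forall>v\<in>S. (\<lambda>x y. x \<in> S \<and> y \<in> S \<and> E x y)\<^sup>*\<^sup>* u v)"

definition clique :: "('a \<Rightarrow> 'a \<Rightarrow> bool) \<Rightarrow> 'a set \<Rightarrow> bool" where
  "clique E K \<longleftrightarrow> (\<forall>u\<in>K. \<forall>v\<in>K. u \<noteq> v \<longrightarrow> E u v)"

definition maximal_cliques :: "'a set \<Rightarrow> ('a \<Rightarrow> 'a \<Rightarrow> bool) \<Rightarrow> 'a set set" where
  "maximal_cliques S E =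
     {K. K \<subseteq> S \<and> clique E K \<and> (\<forall>L. K \<subseteq> L \<and> L \<subseteq> S \<and> clique E L \<longrightarrow> L = K)}"

definition square_geometric :: "'a set \<Rightarrow> ('a \<Rightarrow> 'a \<Rightarrow> bool) \<Rightarrow> bool" where
  "square_geometric V E \<longleftrightarrow> (\<exists>p :: 'a \<Rightarrow> real ^ 2.
     \<forall>u\<in>V. \<forall>v\<in>V. u \<noteq> v \<longrightarrow> (E u v \<longleftrightarrow> infnorm (p u - p v) \<le> 1))"

definition unit_interval_graph :: "'a set \<Rightarrow> ('a \<Rightarrow> 'a \<Rightarrow> bool) \<Rightarrow> bool" where
  "unit_interval_graph S E \<longleftrightarrow> (\<exists>l :: 'a \<Rightarrow> real.
     \<forall>u\<in>S. \<forall>v\<in>S. u \<noteq> v \<longrightarrow> (E u v \<longleftrightarrow> {l u..l u + 1} \<inter> {l v..l v + 1} \<noteq> {}))"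

definition binate_interval_graph :: "'a set \<Rightarrow> ('a \<Rightarrow> 'a \<Rightarrow> bool) \<Rightarrow> bool" where
  "binate_interval_graph V E \<longleftrightarrow> (\<exists>S T. S \<union> T = V \<and> S \<inter> T = {} \<and>
     connected_graph S E \<and> unit_interval_graph S E \<and>
     connected_graph T E \<and> unit_interval_graph T E)"

text \<open>The last conjunct says that \<open>Xa\<close> and \<open>Xb\<close> are \<^emph>\<open>the\<close> cliques of the interval graph
  induced by \<open>X = Xa \<union> Xb\<close>: either \<open>Xa = Xb = X\<close>, or \<open>Xa - Xb\<close> and \<open>Xb - Xa\<close> are
  nonempty with no edge between them.  If \<open>Xa\<close> and \<open>Xb\<close> were arbitrary complete sets
  covering \<open>X\<close>, then the \<open>a\<close>- and \<open>b\<close>-vertices of a graph whose \<open>X\<close> is complete could be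
  chosen at will, and the coloring statement would be false already for seven vertices.\<close>

definition clique_bipartition ::
    "'a set \<Rightarrow> ('a \<Rightarrow> 'a \<Rightarrow> bool) \<Rightarrow> 'a set \<Rightarrow> 'a set \<Rightarrow> 'a set \<Rightarrow> bool" where
  "clique_bipartition V E Xa Xb Y \<longleftrightarrow>
     (Xa \<union> Xb) \<union> Y = V \<and> (Xa \<union> Xb) \<inter> Y = {} \<and>
     clique E Xa \<and> clique E Xb \<and> clique E Y \<and> Xa \<inter> Xb \<noteq> {} \<and>
     maximal_cliques (Xa \<union> Xb) E = {Xa, Xb}"

definition Bab_graph ::
    "'a set \<Rightarrow> ('a \<Rightarrow> 'a \<Rightarrow> bool) \<Rightarrow> 'a set \<Rightarrow> 'a set \<Rightarrow> 'a set \<Rightarrow> bool" where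
  "Bab_graph V E Xa Xb Y \<longleftrightarrow> simple_graph V E \<and> binate_interval_graph V E \<and>
     clique_bipartition V E Xa Xb Y"

definition induced_C4 :: "('a \<Rightarrow> 'a \<Rightarrow> bool) \<Rightarrow> 'a \<Rightarrow> 'a \<Rightarrow> 'a \<Rightarrow> 'a \<Rightarrow> bool" where
  "induced_C4 E s t u v \<longleftrightarrow> distinct [s, t, u, v] \<and>
     E s t \<and> E t u \<and> E u v \<and> E v s \<and> \<not> E s u \<and> \<not> E t v"

definition rigid_pair ::
    "('a \<Rightarrow> 'a \<Rightarrow> bool) \<Rightarrow> 'a set \<Rightarrow> 'a set \<Rightarrow> 'a \<Rightarrow> 'a \<Rightarrow> 'a \<Rightarrow> 'a \<Rightarrow> bool" where
  "rigid_pair E X Y x1 y1 x2 y2 \<longleftrightarrow>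
     x1 \<in> X \<and> x2 \<in> X \<and> y1 \<in> Y \<and> y2 \<in> Y \<and> induced_C4 E x1 y1 y2 x2"

text \<open>A non-edge \<open>xy\<close> with \<open>x \<in> X\<close>, \<open>y \<in> Y\<close> is represented by the pair \<open>(x, y)\<close>, which
  is determined by the non-edge because \<open>X\<close> and \<open>Y\<close> are disjoint.\<close>

definition chord_verts ::
    "('a \<Rightarrow> 'a \<Rightarrow> bool) \<Rightarrow> 'a set \<Rightarrow> 'a set \<Rightarrow> ('a \<times> 'a) set" where
  "chord_verts E X Y = {(x, y). x \<in> X \<and> y \<in> Y \<and> \<not> E x y}"

definition chord_adj ::
    "('a \<Rightarrow> 'a \<Rightarrow> bool) \<Rightarrow> 'a set \<Rightarrow> 'a set \<Rightarrow> 'a \<times> 'a \<Rightarrow> 'a \<times> 'a \<Rightarrow> bool" where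
  "chord_adj E X Y c d \<longleftrightarrow>
     (\<exists>x1 y1 x2 y2. rigid_pair E X Y x1 y1 x2 y2 \<and> {c, d} = {(x1, y2), (x2, y1)})"

definition a_verts ::
    "('a \<Rightarrow> 'a \<Rightarrow> bool) \<Rightarrow> 'a set \<Rightarrow> 'a set \<Rightarrow> 'a set \<Rightarrow> ('a \<times> 'a) set" where
  "a_verts E Xa Xb Y = {c \<in> chord_verts E (Xa \<union> Xb) Y. fst c \<in> Xa - Xb}"

definition b_verts ::
    "('a \<Rightarrow> 'a \<Rightarrow> bool) \<Rightarrow> 'a set \<Rightarrow> 'a set \<Rightarrow> 'a set \<Rightarrow> ('a \<times> 'a) set" where
  "b_verts E Xa Xb Y = {c \<in> chord_verts E (Xa \<union> Xb) Y. fst c \<in> Xb - Xa}"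

definition calA ::
    "('a \<Rightarrow> 'a \<Rightarrow> bool) \<Rightarrow> 'a set \<Rightarrow> 'a set \<Rightarrow> 'a set \<Rightarrow> ('a \<times> 'a) set" where
  "calA E Xa Xb Y = {c \<in> a_verts E Xa Xb Y.
     (\<exists>d \<in> chord_verts E (Xa \<union> Xb) Y. chord_adj E (Xa \<union> Xb) Y c d) \<and>
     (\<exists>d \<in> chord_verts E (Xa \<union> Xb) Y.
        chord_adj E (Xa \<union> Xb) Y c d \<and> d \<notin> a_verts E Xa Xb Y)}"

definition calB ::
    "('a \<Rightarrow> 'a \<Rightarrow> bool) \<Rightarrow> 'a set \<Rightarrow> 'a set \<Rightarrow> 'a set \<Rightarrow> ('a \<times> 'a) set" where
  "calB E Xa Xb Y = {c \<in> b_verts E Xa Xb Y.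
     (\<exists>d \<in> chord_verts E (Xa \<union> Xb) Y.
        chord_adj E (Xa \<union> Xb) Y c d \<and> d \<notin> b_verts E Xa Xb Y)}"

definition assumption_A ::
    "('a \<Rightarrow> 'a \<Rightarrow> bool) \<Rightarrow> 'a set \<Rightarrow> 'a set \<Rightarrow> 'a set \<Rightarrow> bool" where
  "assumption_A E Xa Xb Y \<longleftrightarrow>
     connected_graph (chord_verts E (Xa \<union> Xb) Y) (chord_adj E (Xa \<union> Xb) Y) \<and>
     (\<forall>v \<in> (Xa - Xb) \<union> (Xb - Xa).
        0 < card (nbhd_in E Y v) \<and> card (nbhd_in E Y v) < card Y) \<and>
     (\<forall>b \<in> Xb - Xa. \<exists>u \<in> Xa \<union> Xb. \<not> nbhd_in E Y b \<subseteq> nbhd_in E Y u) \<and>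
     (\<exists>c \<in> chord_verts E (Xa \<union> Xb) Y. \<exists>d \<in> chord_verts E (Xa \<union> Xb) Y.
        chord_adj E (Xa \<union> Xb) Y c d \<and>
        c \<notin> a_verts E Xa Xb Y \<union> b_verts E Xa Xb Y \<and>
        d \<notin> a_verts E Xa Xb Y \<union> b_verts E Xa Xb Y)"

definition rigid_free ::
    "('a \<Rightarrow> 'a \<Rightarrow> bool) \<Rightarrow> 'a set \<Rightarrow> 'a set \<Rightarrow> 'a \<Rightarrow> 'a set \<Rightarrow> bool" where
  "rigid_free E X Y v S \<longleftrightarrow>
     \<not> (\<exists>x1 y1 x2 y2. rigid_pair E X Y x1 y1 x2 y2 \<and> {x1, x2} \<subseteq> S \<and>
          y1 \<in> nbhd_in E Y v \<and> y2 \<in> nbhd_in E Y v)"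

definition rigid_free_conditions ::
    "('a \<Rightarrow> 'a \<Rightarrow> bool) \<Rightarrow> 'a set \<Rightarrow> 'a set \<Rightarrow> 'a set \<Rightarrow> bool" where
  "rigid_free_conditions E Xa Xb Y \<longleftrightarrow>
     (\<forall>a \<in> Xa - Xb.
        (\<forall>x1 \<in> Xa \<inter> Xb. \<forall>x2 \<in> Xa \<inter> Xb. rigid_free E (Xa \<union> Xb) Y a {x1, x2}) \<and>
        (\<forall>x \<in> Xa \<inter> Xb. \<forall>b \<in> Xb - Xa. rigid_free E (Xa \<union> Xb) Y a {x, b})) \<or>
     (\<forall>b \<in> Xb - Xa.
        (\<forall>x1 \<in> Xa \<inter> Xb. \<forall>x2 \<in> Xa \<inter> Xb. rigid_free E (Xa \<union> Xb) Y b {x1, x2}) \<and>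
        (\<forall>x \<in> Xa \<inter> Xb. \<forall>a \<in> Xa - Xb. rigid_free E (Xa \<union> Xb) Y b {x, a}))"

datatype color = Red | Blue

definition proper_coloring ::
    "'v set \<Rightarrow> ('v \<Rightarrow> 'v \<Rightarrow> bool) \<Rightarrow> ('v \<Rightarrow> 'c) \<Rightarrow> bool" where
  "proper_coloring W R f \<longleftrightarrow> (\<forall>c\<in>W. \<forall>d\<in>W. R c d \<longrightarrow> f c \<noteq> f d)"

end

theory Submission
  imports Defs
begin

text \<open>
  Write \<open>p\<close>, \<open>q\<close> for the two coordinates of a square geometric placement.  A chord is a
  non-edge, so it is separated in \<open>p\<close> or in \<open>q\<close>, and the two chords of a rigid pair are never
  separated in the same coordinate: coloring a chord by its separating coordinate is proper on all
  non-isolated chords.  A rigid pair inside \<open>Xa \<inter> Xb\<close> shows, after reflecting the coordinates, that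
  every chord \<open>xy\<close> has \<open>x\<close> below \<open>y\<close> in its separating coordinate.

  A vertex \<open>a\<close> of \<open>Xa - Xb\<close> and a vertex \<open>b\<close> of \<open>Xb - Xa\<close> are separated in one of four ways: in \<open>p\<close>
  or in \<open>q\<close>, with \<open>a\<close> below or above \<open>b\<close>.  If \<open>a\<close> is below \<open>b\<close> in a coordinate, then no chord
  at \<open>b\<close> is separated in that coordinate, because \<open>a\<close> has a neighbor in \<open>Y\<close>.  On the other hand, a
  chord at \<open>a\<close> that is opposite to a chord of \<open>Xa \<inter> Xb\<close> separated in \<open>p\<close> forces \<open>a\<close> not to be below
  any \<open>b\<close> in \<open>p\<close>.  Comparing these restrictions over all pairs \<open>(a, b)\<close> yields both claims; the
  connectedness of the chord graph enters only to provide elements of both distinguished sets.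
\<close>

section \<open>Separation of chords in the two coordinates\<close>

definition crossing :: "('a \<Rightarrow> 'a \<Rightarrow> bool) \<Rightarrow> 'a \<Rightarrow> 'a \<Rightarrow> 'a \<Rightarrow> 'a \<Rightarrow> bool" where
  "crossing E x1 y1 x2 y2 \<longleftrightarrow> E x1 y1 \<and> E x2 y2 \<and> \<not> E x1 y2 \<and> \<not> E x2 y1"

lemma rtranclp_enters:
  assumes "R\<^sup>*\<^sup>* u v" "\<not> P u" "P v"
  obtains x y where "R x y" "\<not> P x" "P y"
  using assms by (induction) blast+

text \<open>Here \<open>A\<close>, \<open>B\<close>, \<open>C\<close> stand for \<open>Xa - Xb\<close>, \<open>Xb - Xa\<close>, \<open>Xa \<inter> Xb\<close>.\<close>

locale oriented_placement =
  fixes A B C Y :: "'a set" and E :: "'a \<Rightarrow> 'a \<Rightarrow> bool" and p q :: "'a \<Rightarrow> real"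
  assumes E_iff: "\<lbrakk>x \<in> A \<union> B \<union> C; y \<in> Y\<rbrakk> \<Longrightarrow> E x y \<longleftrightarrow> p y \<le> p x + 1 \<and> q y \<le> q x + 1"
    and Y_close: "\<lbrakk>y \<in> Y; z \<in> Y\<rbrakk> \<Longrightarrow> p y \<le> p z + 1 \<and> q y \<le> q z + 1"
    and C_close: "\<lbrakk>c \<in> C; x \<in> A \<union> B \<union> C\<rbrakk> \<Longrightarrow> p x \<le> p c + 1 \<and> q x \<le> q c + 1"
    and AB_far: "\<lbrakk>a \<in> A; b \<in> B\<rbrakk> \<Longrightarrow>
      p a + 1 < p b \<or> q a + 1 < q b \<or> p b + 1 < p a \<or> q b + 1 < q a"
    and nbr: "x \<in> A \<union> B \<Longrightarrow> \<exists>y\<in>Y. E x y"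
    and non_nbr: "x \<in> A \<union> B \<Longrightarrow> \<exists>y\<in>Y. \<not> E x y"
begin

lemma swap: "oriented_placement A B C Y E q p"
proof
  show "E x y \<longleftrightarrow> q y \<le> q x + 1 \<and> p y \<le> p x + 1" if "x \<in> A \<union> B \<union> C" "y \<in> Y" for x y
    using E_iff[OF that] by blast
  show "q a + 1 < q b \<or> p a + 1 < p b \<or> q b + 1 < q a \<or> p b + 1 < p a"
    if "a \<in> A" "b \<in> B" for a b
    using AB_far[OF that] by blast
qed (use Y_close C_close nbr non_nbr in blast)+

text \<open>The chord \<open>(x, y)\<close> is opposite to a chord \<open>(c, z)\<close> at
  \<open>C\<close>. Members of \<open>calA\<close> and \<open>calB\<close> are of this kind, as no
  edge joins \<open>A\<close> to \<open>B\<close>.\<close>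

definition mixed :: "'a \<Rightarrow> 'a \<Rightarrow> bool" where
  "mixed x y \<longleftrightarrow> y \<in> Y \<and> (\<exists>c\<in>C. \<exists>z\<in>Y. crossing E x z c y)"

text \<open>Both chords separated in \<open>p\<close> would give
  \<open>p x1 + 1 < p y2 \<le> p x2 + 1 < p y1 \<le> p x1 + 1\<close>; likewise for
  \<open>q\<close>.\<close>

lemma crossing_separated:
  assumes "x1 \<in> A \<union> B \<union> C" "x2 \<in> A \<union> B \<union> C" "y1 \<in> Y" "y2 \<in> Y" "crossing E x1 y1 x2 y2"
  shows "p x1 + 1 < p y2 \<and> \<not> q x1 + 1 < q y2 \<and> q x2 + 1 < q y1 \<and> \<not> p x2 + 1 < p y1 \<or>
         q x1 + 1 < q y2 \<and> \<not> p x1 + 1 < p y2 \<and> p x2 + 1 < p y1 \<and> \<not> q x2 + 1 < q y1"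
proof -
  have "p y1 \<le> p x1 + 1" "q y1 \<le> q x1 + 1" "p y2 \<le> p x2 + 1" "q y2 \<le> q x2 + 1"
    using assms E_iff unfolding crossing_def by blast+
  moreover have "p x1 + 1 < p y2 \<or> q x1 + 1 < q y2" "p x2 + 1 < p y1 \<or> q x2 + 1 < q y1"
    using assms E_iff unfolding crossing_def by (meson not_le)+
  ultimately show ?thesis by linarith
qed

text \<open>Otherwise \<open>y\<close> would lie more than 1 above a neighbor of \<open>u\<close> in
  the clique \<open>Y\<close>.\<close>

lemma above_not_separated:
  assumes "u \<in> A \<union> B" "y \<in> Y" "p v + 1 < p y"
  shows "\<not> p u + 1 < p v"
proof -
  obtain z where "z \<in> Y" "E u z" using nbr assms by blast
  then have "p z \<le> p u + 1" using E_iff assms by blast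
  then show ?thesis
    using Y_close[OF \<open>y \<in> Y\<close> \<open>z \<in> Y\<close>] assms by linarith
qed

text \<open>The neighbor \<open>y\<close> beyond the reach of \<open>c\<close> puts \<open>u\<close>
  above \<open>c\<close>, while \<open>v\<close> is at most 1 above \<open>c\<close>.\<close>

lemma not_below_if_sees_past:
  assumes "u \<in> A \<union> B" "v \<in> A \<union> B" "c \<in> C" "y \<in> Y" "E u y" "p c + 1 < p y"
  shows "\<not> p u + 1 < p v"
proof -
  have "p y \<le> p u + 1" using E_iff assms by blast
  moreover have "p v \<le> p c + 1" using C_close assms by blast
  ultimately show ?thesis using assms by linarith
qed

text \<open>The opposite chord \<open>(c, z)\<close> is then separated in \<open>p\<close>, and
  \<open>u\<close> sees \<open>z\<close>.\<close>

lemma mixed_not_below: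
  assumes "u \<in> A \<union> B" "v \<in> A \<union> B" "mixed u y" "q u + 1 < q y"
  shows "\<not> p u + 1 < p v"
proof -
  obtain c z where c: "c \<in> C" "z \<in> Y" "y \<in> Y" "crossing E u z c y"
    using assms unfolding mixed_def by blast
  then have "p c + 1 < p z"
    using crossing_separated[of u c z y] assms by blast
  then show ?thesis
    using not_below_if_sees_past[of u v c z] c assms unfolding crossing_def by blast
qed

lemma mixed_cases:
  assumes "u \<in> A \<union> B" "mixed u y"
  shows "p u + 1 < p y \<longleftrightarrow> \<not> q u + 1 < q y"
  using assms crossing_separated[of u] unfolding mixed_def by blast

interpretation swapped: oriented_placement A B C Y E q p
  by (rule swap)

text \<open>If both chords were separated in one coordinate, \<open>above_not_separated\<close>
  would rule out that coordinate for separating \<open>a\<close> from \<open>b\<close>, and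
  \<open>mixed_not_below\<close> the other.\<close>

lemma mixed_opposite:
  assumes "a \<in> A" "b \<in> B" "mixed a y" "mixed b z"
  shows "p a + 1 < p y \<longleftrightarrow> \<not> p b + 1 < p z"
proof (rule ccontr)
  assume same: "\<not> ?thesis"
  have Y: "y \<in> Y" "z \<in> Y" using assms by (auto simp: mixed_def)
  have AB: "a \<in> A \<union> B" "b \<in> A \<union> B" using assms by auto
  show False
  proof (cases "p a + 1 < p y")
    case True
    then have b: "p b + 1 < p z" using same by blast
    show False
      using AB_far[OF assms(1,2)]
        above_not_separated[OF AB(1) Y(2) b] above_not_separated[OF AB(2) Y(1) True]
        swapped.mixed_not_below[OF AB assms(3) True] swapped.mixed_not_below[OF AB(2,1) assms(4) b]
      by blast
  next
    case False
    then have a: "q a + 1 < q y" and b: "q b + 1 < q z"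
      using same mixed_cases AB assms by blast+
    show False
      using AB_far[OF assms(1,2)]
        swapped.above_not_separated[OF AB(1) Y(2) b] swapped.above_not_separated[OF AB(2) Y(1) a]
        mixed_not_below[OF AB assms(3) a] mixed_not_below[OF AB(2,1) assms(4) b]
      by blast
  qed
qed

text \<open>Here \<open>a\<close> and \<open>b\<close> witness the failure of the two rigid-free
  alternatives. This leaves two ways to separate them; each is refuted with a vertex
  \<open>a'\<close> or \<open>b'\<close> known to carry a mixed chord.\<close>

lemma rigid_free_alternative:
  assumes redA: "\<And>a y. \<lbrakk>a \<in> A; mixed a y\<rbrakk> \<Longrightarrow> p a + 1 < p y"
    and blueB: "\<And>b y. \<lbrakk>b \<in> B; mixed b y\<rbrakk> \<Longrightarrow> \<not> p b + 1 < p y"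
    and exA: "a' \<in> A" "mixed a' y'" and exB: "b' \<in> B" "mixed b' z'"
    and a: "a \<in> A" "c \<in> C" "x \<in> C \<union> B" "y1 \<in> Y" "y2 \<in> Y" "E a y1" "E a y2"
      "crossing E c y1 x y2"
    and b: "b \<in> B" "d \<in> C" "w \<in> C \<union> A" "z1 \<in> Y" "z2 \<in> Y" "E b z1" "E b z2"
      "crossing E d z1 w z2"
  shows False
proof -
  have AB: "a \<in> A \<union> B" "b \<in> A \<union> B" "a' \<in> A \<union> B" "b' \<in> A \<union> B"
    using a(1) b(1) exA(1) exB(1) by auto
  \<comment> \<open>One of the chords \<open>(c, y2)\<close>, \<open>(x, y1)\<close> is separated in
    \<open>p\<close>, and \<open>a\<close> sees both \<open>y1\<close> and \<open>y2\<close>. If it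
    is \<open>(x, y1)\<close>, then \<open>blueB\<close> puts \<open>x\<close> in
    \<open>C\<close>.\<close>
  have a_not_below: "\<not> p a + 1 < p v" if v: "v \<in> A \<union> B" for v
  proof (cases "p c + 1 < p y2")
    case True
    show ?thesis by (rule not_below_if_sees_past[OF AB(1) v a(2,5,7) True])
  next
    case False
    then have px: "p x + 1 < p y1"
      using crossing_separated[of c x y1 y2] a by blast
    have "x \<notin> B"
    proof
      assume "x \<in> B"
      moreover have "mixed x y1" using a unfolding mixed_def crossing_def by blast
      ultimately show False using blueB px by blast
    qed
    then show ?thesis using not_below_if_sees_past[OF AB(1) v _ a(4,6) px] a(3) by blast
  qed
  have b_not_below: "\<not> q b + 1 < q v" if v: "v \<in> A \<union> B" for v
  proof (cases "q d + 1 < q z2")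
    case True
    show ?thesis by (rule swapped.not_below_if_sees_past[OF AB(2) v b(2,5,7) True])
  next
    case False
    then have sep: "q w + 1 < q z1" "\<not> p w + 1 < p z1"
      using crossing_separated[of d w z1 z2] b by blast+
    have "w \<notin> A"
    proof
      assume "w \<in> A"
      moreover have "mixed w z1" using b unfolding mixed_def crossing_def by blast
      ultimately show False using redA sep by blast
    qed
    then show ?thesis using swapped.not_below_if_sees_past[OF AB(2) v _ b(4,6) sep(1)] b(3) by blast
  qed
  have Y: "y' \<in> Y" "z' \<in> Y" using exA exB by (auto simp: mixed_def)
  have red: "p a' + 1 < p y'" using redA exA by blast
  have blue: "q b' + 1 < q z'" using blueB[OF exB] mixed_cases[OF AB(4) exB(2)] by blast
  have "q a + 1 < q b \<or> p b + 1 < p a"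
    using AB_far[OF a(1) b(1)] a_not_below[OF AB(2)] b_not_below[OF AB(1)] by blast
  then show False
  proof
    \<comment> \<open>Every chord at \<open>b\<close> is now separated in \<open>p\<close> only, so
      no way remains to separate \<open>a'\<close> from \<open>b\<close>.\<close>
    assume below: "q a + 1 < q b"
    obtain z where z: "z \<in> Y" "\<not> E b z" using non_nbr[OF AB(2)] by blast
    have "\<not> q b + 1 < q z"
      using swapped.above_not_separated[OF AB(1) z(1)] below by blast
    then have "p b + 1 < p z" using E_iff[of b z] AB(2) z by auto
    then show False
      using AB_far[OF exA(1) b(1)] above_not_separated[OF AB(3) z(1)]
        swapped.mixed_not_below[OF AB(3,2) exA(2) red]
        above_not_separated[OF AB(2) Y(1) red] b_not_below[OF AB(3)]
      by blast
  next
    assume below: "p b + 1 < p a"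
    obtain z where z: "z \<in> Y" "\<not> E a z" using non_nbr[OF AB(1)] by blast
    have "\<not> p a + 1 < p z"
      using above_not_separated[OF AB(2) z(1)] below by blast
    then have "q a + 1 < q z" using E_iff[of a z] AB(1) z by auto
    then show False
      using AB_far[OF a(1) exB(1)] swapped.above_not_separated[OF AB(4) z(1)]
        mixed_not_below[OF AB(4,1) exB(2) blue]
        swapped.above_not_separated[OF AB(1) Y(2) blue] a_not_below[OF AB(4)]
      by blast
  qed
qed

end

section \<open>Existence of an oriented placement\<close>

lemma infnorm_vec2: "infnorm (v :: real ^ 2) \<le> 1 \<longleftrightarrow> \<bar>v $ 1\<bar> \<le> 1 \<and> \<bar>v $ 2\<bar> \<le> 1"
proof -
  have "{\<bar>v \<bullet> i\<bar> |i. i \<in> Basis} = {\<bar>v $ 1\<bar>, \<bar>v $ 2\<bar>}"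
    by (auto simp: Basis_vec_def UNIV_2 inner_axis intro: exI[of _ "axis 1 1"] exI[of _ "axis 2 1"])
  then show ?thesis by (simp add: infnorm_def cSup_eq_Max)
qed

text \<open>A pair in \<open>C \<times> Y\<close> separated in \<open>p\<close> decides whether \<open>p\<close> has to be reflected: vertices of \<open>C\<close>
  are close to all of \<open>X\<close>, and \<open>Y\<close> is a clique, so no pair is separated the other way round.\<close>

lemma orient_coordinate:
  fixes p :: "'a \<Rightarrow> real"
  assumes "c \<in> C" "z \<in> Y" "1 < \<bar>p c - p z\<bar>"
    and C: "\<And>c x. c \<in> C \<Longrightarrow> x \<in> X \<Longrightarrow> \<bar>p c - p x\<bar> \<le> 1"
    and Y: "\<And>y z. y \<in> Y \<Longrightarrow> z \<in> Y \<Longrightarrow> \<bar>p y - p z\<bar> \<le> 1"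
  obtains p' where "\<And>u v. \<bar>p' u - p' v\<bar> = \<bar>p u - p v\<bar>"
    and "\<And>x y. x \<in> X \<Longrightarrow> y \<in> Y \<Longrightarrow> p' x \<le> p' y + 1"
proof (cases "p c < p z")
  case True
  have "p x \<le> p y + 1" if "x \<in> X" "y \<in> Y" for x y
    using C[of c x] Y[of y z] that assms(1-3) True by argo
  then show ?thesis using that[of p] by simp
next
  case False
  have "- p x \<le> - p y + 1" if "x \<in> X" "y \<in> Y" for x y
    using C[of c x] Y[of y z] that assms(1-3) False by argo
  then show ?thesis using that[of "\<lambda>u. - p u"] by simp
qed

text \<open>Two diagonal gaps add up to more than 2, but the sum regroups into differences along two
  opposite sides, each at most 1.\<close>

lemma C4_chord_unseparated:
  fixes p :: "'a \<Rightarrow> real"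
  assumes "\<bar>p s - p t\<bar> \<le> 1" "\<bar>p t - p u\<bar> \<le> 1" "\<bar>p u - p v\<bar> \<le> 1" "\<bar>p v - p s\<bar> \<le> 1"
  shows "\<bar>p s - p u\<bar> \<le> 1 \<or> \<bar>p t - p v\<bar> \<le> 1"
proof (rule ccontr)
  assume "\<not> ?thesis"
  then have "1 < p s - p u \<or> 1 < p u - p s" "1 < p t - p v \<or> 1 < p v - p t"
    by linarith+
  then show False
    using assms[unfolded abs_le_iff] by linarith
qed

lemma clique_extends_to_maximal:
  assumes "finite S" "K \<subseteq> S" "clique E K"
  obtains M where "M \<in> maximal_cliques S E" "K \<subseteq> M"
proof -
  let ?F = "{L. L \<subseteq> S \<and> clique E L}"
  have "finite ?F" using assms(1) by simp
  moreover have "K \<in> ?F" using assms by simp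
  ultimately obtain M where "M \<in> ?F" "K \<subseteq> M" "\<And>L. L \<in> ?F \<Longrightarrow> M \<subseteq> L \<Longrightarrow> L = M"
    using finite_has_maximal2 by (metis (no_types, lifting))
  then show ?thesis by (intro that[of M]) (simp_all add: maximal_cliques_def)
qed

text \<open>A clique \<open>{a, b}\<close> would extend to a maximal clique other than
  \<open>Xa\<close> and \<open>Xb\<close>.\<close>

lemma clique_bipartition_no_edge:
  assumes "simple_graph V E" "clique_bipartition V E Xa Xb Y" "a \<in> Xa - Xb" "b \<in> Xb - Xa"
  shows "\<not> E a b"
proof
  assume "E a b"
  then have "clique E {a, b}"
    using assms(1) unfolding simple_graph_def clique_def by blast
  moreover have "finite (Xa \<union> Xb)"
    using assms(1,2) unfolding simple_graph_def clique_bipartition_def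
    by (metis finite_Un)
  ultimately obtain M where "M \<in> maximal_cliques (Xa \<union> Xb) E" "{a, b} \<subseteq> M"
    using clique_extends_to_maximal[of "Xa \<union> Xb" "{a, b}" E] assms(3,4) by blast
  moreover have "maximal_cliques (Xa \<union> Xb) E = {Xa, Xb}"
    using assms(2) unfolding clique_bipartition_def by simp
  ultimately show False using assms(3,4) by blast
qed

lemma clique_bipartition_subset_eq:
  assumes "clique_bipartition V E Xa Xb Y" "Xa \<subseteq> Xb \<or> Xb \<subseteq> Xa"
  shows "Xa = Xb"
proof -
  have max: "Xa \<in> maximal_cliques (Xa \<union> Xb) E" "Xb \<in> maximal_cliques (Xa \<union> Xb) E"
    and "clique E Xa" "clique E Xb"
    using assms(1) unfolding clique_bipartition_def by simp_all
  then have "Xa \<subseteq> Xb \<Longrightarrow> Xb = Xa" "Xb \<subseteq> Xa \<Longrightarrow> Xa = Xb"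
    unfolding maximal_cliques_def by simp_all
  then show ?thesis using assms(2) by blast
qed

lemma oriented_placement_exists:
  assumes "Bab_graph V E Xa Xb Y" "square_geometric V E" "assumption_A E Xa Xb Y"
  obtains p q where "oriented_placement (Xa - Xb) (Xb - Xa) (Xa \<inter> Xb) Y E p q"
proof -
  let ?X = "Xa \<union> Xb" and ?C = "Xa \<inter> Xb"
  have sg: "simple_graph V E" and cb: "clique_bipartition V E Xa Xb Y"
    using assms(1) unfolding Bab_graph_def by auto
  have inV: "u \<in> V \<and> v \<in> V \<and> u \<noteq> v" if "E u v" for u v
    using sg that unfolding simple_graph_def by simp
  have XY: "?X \<union> Y = V" "?X \<inter> Y = {}" and cl: "clique E Xa" "clique E Xb" "clique E Y"
    using cb unfolding clique_bipartition_def by simp_all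
  obtain P :: "'a \<Rightarrow> real ^ 2" where
    P: "\<And>u v. u \<in> V \<Longrightarrow> v \<in> V \<Longrightarrow> u \<noteq> v \<Longrightarrow> E u v \<longleftrightarrow> infnorm (P u - P v) \<le> 1"
    using assms(2) unfolding square_geometric_def by blast
  define p q where "p u = P u $ 1" and "q u = P u $ 2" for u
  have E_iff: "E u v \<longleftrightarrow> \<bar>p u - p v\<bar> \<le> 1 \<and> \<bar>q u - q v\<bar> \<le> 1"
    if "u \<in> V" "v \<in> V" "u \<noteq> v" for u v
    using P[OF that] by (simp add: infnorm_vec2 p_def q_def)
  have E_close: "\<bar>p u - p v\<bar> \<le> 1 \<and> \<bar>q u - q v\<bar> \<le> 1" if "E u v \<or> u = v" for u v
    using that inV[of u v] E_iff[of u v] by fastforce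
  have Cc: "\<bar>p c - p x\<bar> \<le> 1 \<and> \<bar>q c - q x\<bar> \<le> 1" if "c \<in> ?C" "x \<in> ?X" for c x
    by (rule E_close) (use that cl in \<open>auto simp: clique_def\<close>)
  have Yc: "\<bar>p y - p z\<bar> \<le> 1 \<and> \<bar>q y - q z\<bar> \<le> 1" if "y \<in> Y" "z \<in> Y" for y z
    by (rule E_close) (use that cl in \<open>auto simp: clique_def\<close>)
  obtain c d where cd: "c \<in> chord_verts E ?X Y" "d \<in> chord_verts E ?X Y" "chord_adj E ?X Y c d"
    "c \<notin> a_verts E Xa Xb Y \<union> b_verts E Xa Xb Y" "d \<notin> a_verts E Xa Xb Y \<union> b_verts E Xa Xb Y"
    using assms(3) unfolding assumption_A_def by blast
  from cd(3) obtain x1 y1 x2 y2 where r: "rigid_pair E ?X Y x1 y1 x2 y2" "{c, d} = {(x1, y2), (x2, y1)}"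
    unfolding chord_adj_def by blast
  then have x12: "x1 \<in> ?C" "x2 \<in> ?C"
    using cd(1,2,4,5) unfolding a_verts_def b_verts_def
    by (auto simp: doubleton_eq_iff rigid_pair_def)
  have y12: "y1 \<in> Y" "y2 \<in> Y" using r unfolding rigid_pair_def by auto
  have C4: "E x1 y1" "E y1 y2" "E y2 x2" "E x2 x1" "\<not> E x1 y2" "\<not> E y1 x2"
    "x1 \<noteq> y2" "y1 \<noteq> x2"
    using r unfolding rigid_pair_def induced_C4_def by auto
  have pun: "\<not> (1 < \<bar>p x1 - p y2\<bar> \<and> 1 < \<bar>p x2 - p y1\<bar>)"
    using C4_chord_unseparated[of p x1 y1 y2 x2] C4(1-4)[THEN disjI1, THEN E_close]
    by (simp add: abs_minus_commute[of "p x2" "p y1"] not_less)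
  have qun: "\<not> (1 < \<bar>q x1 - q y2\<bar> \<and> 1 < \<bar>q x2 - q y1\<bar>)"
    using C4_chord_unseparated[of q x1 y1 y2 x2] C4(1-4)[THEN disjI1, THEN E_close]
    by (simp add: abs_minus_commute[of "q x2" "q y1"] not_less)
  have sep1: "1 < \<bar>p x1 - p y2\<bar> \<or> 1 < \<bar>q x1 - q y2\<bar>"
    using E_iff[of x1 y2] C4(5,7) inV[OF C4(1)] inV[OF C4(3)] by force
  have sep2: "1 < \<bar>p x2 - p y1\<bar> \<or> 1 < \<bar>q x2 - q y1\<bar>"
    using E_iff[of y1 x2] C4(6,8) inV[OF C4(1)] inV[OF C4(3)] by (force simp: abs_minus_commute)
  \<comment> \<open>The two chords of this rigid pair use different coordinates, so each coordinate
    separates some pair in \<open>?C\<close> and \<open>Y\<close> and can be oriented.\<close>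
  obtain cp zp where cp: "cp \<in> ?C" "zp \<in> Y" "1 < \<bar>p cp - p zp\<bar>"
    using pun qun sep1 sep2 x12 y12 by blast
  obtain cq zq where cq: "cq \<in> ?C" "zq \<in> Y" "1 < \<bar>q cq - q zq\<bar>"
    using pun qun sep1 sep2 x12 y12 by blast
  obtain p' where p': "\<And>u v. \<bar>p' u - p' v\<bar> = \<bar>p u - p v\<bar>"
    "\<And>x y. x \<in> ?X \<Longrightarrow> y \<in> Y \<Longrightarrow> p' x \<le> p' y + 1"
    using orient_coordinate[of cp ?C zp Y p ?X] cp Cc Yc by blast
  obtain q' where q': "\<And>u v. \<bar>q' u - q' v\<bar> = \<bar>q u - q v\<bar>"
    "\<And>x y. x \<in> ?X \<Longrightarrow> y \<in> Y \<Longrightarrow> q' x \<le> q' y + 1"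
    using orient_coordinate[of cq ?C zq Y q ?X] cq Cc Yc by blast
  have X_eq: "(Xa - Xb) \<union> (Xb - Xa) \<union> ?C = ?X" by blast
  have deg: "0 < card (nbhd_in E Y v) \<and> card (nbhd_in E Y v) < card Y"
    if "v \<in> (Xa - Xb) \<union> (Xb - Xa)" for v
    using assms(3) that unfolding assumption_A_def by blast
  have "oriented_placement (Xa - Xb) (Xb - Xa) ?C Y E p' q'"
  proof (unfold_locales, unfold X_eq)
    \<comment> \<open>The orientation supplies the other half of each absolute value bound.\<close>
    fix x y assume "x \<in> ?X" "y \<in> Y"
    moreover from this have "x \<in> V" "y \<in> V" "x \<noteq> y" using XY by auto
    ultimately show "E x y \<longleftrightarrow> p' y \<le> p' x + 1 \<and> q' y \<le> q' x + 1"
      using E_iff[of x y] p'(1)[of x y] q'(1)[of x y] p'(2)[of x y] q'(2)[of x y]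
      by auto
  next
    fix y z assume "y \<in> Y" "z \<in> Y"
    then show "p' y \<le> p' z + 1 \<and> q' y \<le> q' z + 1"
      using Yc[of y z] p'(1)[of y z] q'(1)[of y z] by force
  next
    fix c x assume "c \<in> ?C" "x \<in> ?X"
    then show "p' x \<le> p' c + 1 \<and> q' x \<le> q' c + 1"
      using Cc[of c x] p'(1)[of c x] q'(1)[of c x] by force
  next
    fix a b assume ab: "a \<in> Xa - Xb" "b \<in> Xb - Xa"
    moreover from this have "a \<in> V" "b \<in> V" "a \<noteq> b" using XY by auto
    ultimately have "\<not> (\<bar>p' a - p' b\<bar> \<le> 1 \<and> \<bar>q' a - q' b\<bar> \<le> 1)"
      using clique_bipartition_no_edge[OF sg cb] E_iff[of a b] p'(1)[of a b] q'(1)[of a b] by simp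
    then show "p' a + 1 < p' b \<or> q' a + 1 < q' b \<or> p' b + 1 < p' a \<or> q' b + 1 < q' a"
      by argo
  next
    fix x assume "x \<in> (Xa - Xb) \<union> (Xb - Xa)"
    then have "nbhd_in E Y x \<noteq> {}" using deg by fastforce
    then show "\<exists>y\<in>Y. E x y" unfolding nbhd_in_def by blast
  next
    fix x assume "x \<in> (Xa - Xb) \<union> (Xb - Xa)"
    then have "nbhd_in E Y x \<noteq> Y" using deg by fastforce
    then show "\<exists>y\<in>Y. \<not> E x y" unfolding nbhd_in_def by blast
  qed
  then show ?thesis by (rule that)
qed

section \<open>Adjacency and connectedness in the chord graph\<close>

lemma rigid_pair_imp_crossing:
  assumes "symp E" "rigid_pair E X Y x1 y1 x2 y2"
  shows "crossing E x1 y1 x2 y2 \<and> E x1 x2 \<and> x1 \<in> X \<and> x2 \<in> X \<and> y1 \<in> Y \<and> y2 \<in> Y"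
  using assms(2) sympD[OF assms(1), of x2 x1] sympD[OF assms(1), of x2 y1]
    sympD[OF assms(1), of y2 x2]
  unfolding rigid_pair_def induced_C4_def crossing_def by blast

text \<open>The unordered pair of chords can be matched in two ways; \<open>crossing\<close> is
  invariant under exchanging the indices.\<close>

lemma chord_adj_imp_crossing:
  assumes sym: "symp E" and adj: "chord_adj E X Y (x1, y2) (x2, y1)"
  shows "crossing E x1 y1 x2 y2 \<and> E x1 x2 \<and> x1 \<in> X \<and> x2 \<in> X \<and> y1 \<in> Y \<and> y2 \<in> Y"
proof -
  from adj have "rigid_pair E X Y x1 y1 x2 y2 \<or> rigid_pair E X Y x2 y2 x1 y1"
    unfolding chord_adj_def by (auto simp: doubleton_eq_iff)
  then show ?thesis
    using rigid_pair_imp_crossing[OF sym, of X Y x1 y1 x2 y2]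
      rigid_pair_imp_crossing[OF sym, of X Y x2 y2 x1 y1] sympD[OF sym, of x2 x1]
    unfolding crossing_def by blast
qed

lemma chord_adj_sym: "chord_adj E X Y c d \<Longrightarrow> chord_adj E X Y d c"
  unfolding chord_adj_def by (simp add: insert_commute)

lemma connected_graph_enters:
  assumes "connected_graph S R" "u \<in> S" "u \<notin> T" "v \<in> S" "v \<in> T"
  obtains x y where "R x y" "x \<in> S" "y \<in> S" "x \<notin> T" "y \<in> T"
proof -
  have "(\<lambda>x y. x \<in> S \<and> y \<in> S \<and> R x y)\<^sup>*\<^sup>* u v"
    using assms unfolding connected_graph_def by blast
  then show ?thesis
    by (rule rtranclp_enters[where P = "\<lambda>x. x \<in> T"]) (use assms that in blast)+
qed

section \<open>The coloring and the rigid-free conditions\<close>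

theorem theorem3p4:
  fixes V Xa Xb Y :: "'a set" and E :: "'a \<Rightarrow> 'a \<Rightarrow> bool"
  assumes "Bab_graph V E Xa Xb Y"
    and "square_geometric V E"
    and "assumption_A E Xa Xb Y"
  shows "(\<exists>f :: 'a \<times> 'a \<Rightarrow> color.
            proper_coloring (chord_verts E (Xa \<union> Xb) Y) (chord_adj E (Xa \<union> Xb) Y) f \<and>
            (\<forall>c \<in> calA E Xa Xb Y. f c = Red) \<and> (\<forall>c \<in> calB E Xa Xb Y. f c = Blue))
         \<and> rigid_free_conditions E Xa Xb Y"
proof -
  let ?A = "Xa - Xb" and ?B = "Xb - Xa" and ?C = "Xa \<inter> Xb" and ?X = "Xa \<union> Xb"
  let ?W = "chord_verts E ?X Y" and ?R = "chord_adj E ?X Y"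
  have sg: "simple_graph V E" and cb: "clique_bipartition V E Xa Xb Y"
    using assms(1) unfolding Bab_graph_def by auto
  have sym: "symp E"
    using sg unfolding simple_graph_def by (simp add: sympI)
  have no_edge: "\<not> E a b" "\<not> E b a" if "a \<in> ?A" "b \<in> ?B" for a b
    using clique_bipartition_no_edge[OF sg cb] that sympD[OF sym] by blast+
  obtain p q where "oriented_placement ?A ?B ?C Y E p q"
    using oriented_placement_exists[OF assms] .
  then interpret oriented_placement ?A ?B ?C Y E p q .
  have X_eq: "?A \<union> ?B \<union> ?C = ?X" by blast
  have conn: "connected_graph ?W ?R" using assms(3) unfolding assumption_A_def by blast
  obtain e where e: "e \<in> ?W" "fst e \<in> ?C"
  proof -
    from assms(3) obtain e where "e \<in> ?W" "e \<notin> a_verts E Xa Xb Y \<union> b_verts E Xa Xb Y"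
      unfolding assumption_A_def by blast
    moreover from this have "fst e \<in> ?X" unfolding chord_verts_def by auto
    ultimately show ?thesis using that[of e] unfolding a_verts_def b_verts_def by blast
  qed

  have mixed_if_adj: "mixed (fst c) (snd c)"
    if "?R c d" "fst c \<in> ?A \<and> fst d \<notin> ?A \<or> fst c \<in> ?B \<and> fst d \<notin> ?B" for c d
  proof -
    obtain x1 y2 x2 y1 where cd: "c = (x1, y2)" "d = (x2, y1)" by (metis surj_pair)
    then have cr: "crossing E x1 y1 x2 y2 \<and> E x1 x2 \<and> x1 \<in> ?X \<and> x2 \<in> ?X \<and> y1 \<in> Y \<and> y2 \<in> Y"
      using chord_adj_imp_crossing[OF sym] that by blast
    \<comment> \<open>The edge \<open>x1 x2\<close> excludes the opposite side.\<close>
    then have "x2 \<in> ?C" using that(2) no_edge cd by auto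
    then show ?thesis using cr cd unfolding mixed_def by auto
  qed
  have calA_mixed: "fst c \<in> ?A \<and> mixed (fst c) (snd c)" if "c \<in> calA E Xa Xb Y" for c
    using that mixed_if_adj unfolding calA_def a_verts_def by blast
  have calB_mixed: "fst c \<in> ?B \<and> mixed (fst c) (snd c)" if "c \<in> calB E Xa Xb Y" for c
    using that mixed_if_adj unfolding calB_def b_verts_def by blast

  have ex_mixed: "\<exists>x\<in>S. \<exists>y. mixed x y" if S: "S = ?A \<or> S = ?B" "S \<noteq> {}" for S
  proof -
    obtain x y where "x \<in> S" "y \<in> Y" "\<not> E x y" using S non_nbr by blast
    then have "(x, y) \<in> ?W" using S unfolding chord_verts_def by auto
    \<comment> \<open>A walk from the chord \<open>e\<close> at \<open>?C\<close> to
      \<open>(x, y)\<close> must enter the chords at \<open>S\<close>; the entering edge ends in a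
      mixed chord.\<close>
    obtain c d where "?R c d" "fst c \<notin> S" "fst d \<in> S"
      by (rule connected_graph_enters[OF conn e(1), of "{c. fst c \<in> S}" "(x, y)"])
        (use e(2) S \<open>x \<in> S\<close> \<open>(x, y) \<in> ?W\<close> in auto)
    then have "mixed (fst d) (snd d)"
      using mixed_if_adj[of d c] S(1) chord_adj_sym by blast
    then show ?thesis using \<open>fst d \<in> S\<close> by blast
  qed
  have A_iff_B: "?A \<noteq> {} \<longleftrightarrow> ?B \<noteq> {}"
    using clique_bipartition_subset_eq[OF cb] by blast

  define red where "red c \<longleftrightarrow> p (fst c) + 1 < p (snd c)" for c
  have red_adj: "red c \<noteq> red d" if "?R c d" for c d
  proof -
    obtain x1 y2 x2 y1 where cd: "c = (x1, y2)" "d = (x2, y1)" by (metis surj_pair)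
    then have "crossing E x1 y1 x2 y2 \<and> x1 \<in> ?X \<and> x2 \<in> ?X \<and> y1 \<in> Y \<and> y2 \<in> Y"
      using chord_adj_imp_crossing[OF sym] that by blast
    then show ?thesis
      using crossing_separated[of x1 x2 y1 y2] unfolding X_eq red_def cd by auto
  qed
  \<comment> \<open>The truth value \<open>s\<close> tells whether the mixed chords at
    \<open>?A\<close> are those separated in \<open>p\<close>; it fixes which coordinate is called
    \<open>Red\<close>.\<close>
  define uniform where "uniform s \<longleftrightarrow>
    (\<forall>x y. x \<in> ?A \<longrightarrow> mixed x y \<longrightarrow> red (x, y) = s) \<and>
    (\<forall>x y. x \<in> ?B \<longrightarrow> mixed x y \<longrightarrow> red (x, y) = (\<not> s))" for s
  have opp: "red (a, y) = (\<not> red (b, z))" if "a \<in> ?A" "b \<in> ?B" "mixed a y" "mixed b z" for a b y z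
    using mixed_opposite[OF that] by (simp add: red_def)
  have "\<exists>s. uniform s"
  proof (cases "?A = {}")
    case True
    then show ?thesis using A_iff_B unfolding uniform_def by blast
  next
    case False
    then obtain a y b z where "a \<in> ?A" "mixed a y" "b \<in> ?B" "mixed b z"
      using ex_mixed[of ?A] ex_mixed[of ?B] A_iff_B by blast
    then have "uniform (red (a, y))" using opp unfolding uniform_def by blast
    then show ?thesis ..
  qed
  then obtain s where s: "uniform s" ..

  let ?f = "\<lambda>c. if red c = s then Red else Blue"
  have "proper_coloring ?W ?R ?f"
    unfolding proper_coloring_def using red_adj by auto
  moreover have "\<forall>c \<in> calA E Xa Xb Y. ?f c = Red" "\<forall>c \<in> calB E Xa Xb Y. ?f c = Blue"
    using calA_mixed calB_mixed s unfolding uniform_def by fastforce+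
  moreover have "rigid_free_conditions E Xa Xb Y"
  proof (rule ccontr)
    assume neg: "\<not> rigid_free_conditions E Xa Xb Y"
    have violation: "\<exists>c\<in>?C. \<exists>x\<in>?C \<union> T. \<exists>y1\<in>Y. \<exists>y2\<in>Y. E v y1 \<and> E v y2 \<and> crossing E c y1 x y2"
      if "\<not> ((\<forall>x1 \<in> ?C. \<forall>x2 \<in> ?C. rigid_free E ?X Y v {x1, x2}) \<and>
              (\<forall>x \<in> ?C. \<forall>b \<in> T. rigid_free E ?X Y v {x, b}))" for v T
    proof -
      from that obtain c x where cx: "c \<in> ?C" "x \<in> ?C \<union> T" "\<not> rigid_free E ?X Y v {c, x}"
        by blast
      then obtain x1 y1 x2 y2 where r: "rigid_pair E ?X Y x1 y1 x2 y2" "{x1, x2} \<subseteq> {c, x}"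
        "E v y1" "E v y2" "y1 \<in> Y" "y2 \<in> Y"
        unfolding rigid_free_def nbhd_in_def by blast
      then have "x1 \<noteq> x2" unfolding rigid_pair_def induced_C4_def by auto
      then have "x1 = c \<and> x2 = x \<or> x1 = x \<and> x2 = c" using r(2) by blast
      moreover have "crossing E x1 y1 x2 y2" "crossing E x2 y2 x1 y1"
        using rigid_pair_imp_crossing[OF sym r(1)] unfolding crossing_def by auto
      ultimately show ?thesis using r cx by blast
    qed
    from neg obtain a b where ab: "a \<in> ?A" "b \<in> ?B"
      and na: "\<not> ((\<forall>x1 \<in> ?C. \<forall>x2 \<in> ?C. rigid_free E ?X Y a {x1, x2}) \<and>
              (\<forall>x \<in> ?C. \<forall>b \<in> ?B. rigid_free E ?X Y a {x, b}))"
      and nb: "\<not> ((\<forall>x1 \<in> ?C. \<forall>x2 \<in> ?C. rigid_free E ?X Y b {x1, x2}) \<and>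
              (\<forall>x \<in> ?C. \<forall>a \<in> ?A. rigid_free E ?X Y b {x, a}))"
      unfolding rigid_free_conditions_def by blast
    obtain c x y1 y2 where va: "c \<in> ?C" "x \<in> ?C \<union> ?B" "y1 \<in> Y" "y2 \<in> Y" "E a y1" "E a y2"
      "crossing E c y1 x y2"
      using violation[OF na] by blast
    obtain d w z1 z2 where vb: "d \<in> ?C" "w \<in> ?C \<union> ?A" "z1 \<in> Y" "z2 \<in> Y" "E b z1" "E b z2"
      "crossing E d z1 w z2"
      using violation[OF nb] by blast
    obtain a' y' b' z' where ex: "a' \<in> ?A" "mixed a' y'" "b' \<in> ?B" "mixed b' z'"
      using ex_mixed[of ?A] ex_mixed[of ?B] ab by blast
    show False
    proof (cases s)
      case True
      show False
        by (rule rigid_free_alternative[OF _ _ ex ab(1) va ab(2) vb])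
          (use s True in \<open>auto simp: uniform_def red_def\<close>)
    next
      case False
      \<comment> \<open>Mixed chords at \<open>?A\<close> are now separated in \<open>q\<close>, so
        exchanging the coordinates reduces to the previous case.\<close>
      interpret swapped: oriented_placement ?A ?B ?C Y E q p by (rule swap)
      have redA: "q x + 1 < q y" if "x \<in> ?A" "mixed x y" for x y
        using mixed_cases[of x y] that s False unfolding uniform_def red_def by auto
      have blueB: "\<not> q x + 1 < q y" if "x \<in> ?B" "mixed x y" for x y
        using mixed_cases[of x y] that s False unfolding uniform_def red_def by auto
      show False
        by (rule swapped.rigid_free_alternative[OF redA blueB ex ab(1) va ab(2) vb])
    qed
  qed
  ultimately show ?thesis by blast
qed

end
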